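(* Let $f:\mathbb{R}^n\to\mathbb{R}$ be a convex function and let $f^*:\mathbb{R}^n\to(-\infty,\infty]$, $f^*(y)=\sup_{x\in\mathbb{R}^n}\bigl(y^{\mathsf T}x-f(x)\bigr)$, be its Fenchel dual. Then the following are equivalent: (a) there exist constants $0<k_f\le K_f$, $1<s\le t$ and $r>0$ such that $k_f\|x\|^s\le f(x)\le K_f\|x\|^t$ whenever $\|x\|\ge r$; (b) there exist constants $0<k_{f^*}\le K_{f^*}$, $1<s'\le t'$ and $r'>0$ such that $k_{f^*}\|y\|^{s'}\le f^*(y)\le K_{f^*}\|y\|^{t'}$ whenever $\|y\|\ge r'$.
   Context: $\|\cdot\|$ is the Euclidean norm on $\mathbb{R}^n$. *)

theory Defs
  imports "HOL-Analysis.Analysis"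
begin

text \<open>The supremum is taken in \<^typ>\<open>ereal\<close>, so it may be \<open>\<infinity>\<close>; it is never \<open>-\<infinity>\<close>, being
  the supremum of a nonempty set of reals.\<close>

definition fenchel_dual :: "(real ^ 'n \<Rightarrow> real) \<Rightarrow> real ^ 'n \<Rightarrow> ereal" where
  "fenchel_dual f y = (SUP x. ereal (y \<bullet> x - f x))"

end

theory Submission
  imports Defs
begin

text \<open>Upper bounds on one function of the pair come from Young's inequality
  \<open>a u - k u\<^sup>s \<le> C a\<^sup>q\<close> with \<open>q = s / (s - 1)\<close>, lower bounds from testing the
  Fenchel--Young inequality \<open>f x + f\<^sup>* y \<ge> y \<bullet> x\<close> at a multiple of the given vector. Equality in
  Fenchel--Young at a subgradient replaces the biconjugation theorem when passing from \<open>f\<^sup>*\<close>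
  back to \<open>f\<close>.\<close>

section \<open>Young-type estimates in one real variable\<close>

text \<open>Split where \<open>a * u\<close> and \<open>k * u powr s\<close> cross. Past the
  crossing the left side is at most 0. Before it, \<open>u\<close> is at most
  \<open>(a / k) powr (1 / (s - 1))\<close>, and dropping the power term already gives the bound,
  with a constant that is not the sharp one.\<close>

lemma linear_minus_powr_le:
  fixes a u k s :: real
  assumes "0 \<le> a" "0 \<le> u" "0 < k" "1 < s"
  shows "a * u - k * u powr s \<le> k powr (- 1 / (s - 1)) * a powr (s / (s - 1))"
proof (cases "a \<le> k * u powr (s - 1)")
  case True
  have "a * u \<le> k * u powr (s - 1) * u"
    using True assms by (intro mult_right_mono) auto
  also have "\<dots> = k * u powr s"
    using assms by (cases "u = 0") (simp_all add: powr_diff)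
  finally show ?thesis
    by (smt (verit) powr_ge_zero mult_nonneg_nonneg)
next
  case False
  then have a: "0 < a"
    using assms by (smt (verit) powr_ge_zero mult_nonneg_nonneg)
  have "u powr (s - 1) \<le> a / k"
    using False assms by (simp add: field_simps)
  then have "(u powr (s - 1)) powr (1 / (s - 1)) \<le> (a / k) powr (1 / (s - 1))"
    using assms by (intro powr_mono2) auto
  then have u: "u \<le> (a / k) powr (1 / (s - 1))"
    using assms by (simp add: powr_powr)
  have e: "s / (s - 1) = 1 + 1 / (s - 1)"
    using assms by (simp add: field_simps)
  have "a * u \<le> a * (a / k) powr (1 / (s - 1))"
    using u a by simp
  also have "\<dots> = k powr (- 1 / (s - 1)) * a powr (s / (s - 1))"
    using a assms unfolding e powr_add by (simp add: powr_divide powr_minus_divide)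
  finally show ?thesis
    using assms by (smt (verit) powr_ge_zero mult_nonneg_nonneg)
qed

text \<open>Adapts the previous bound to growth known only from radius \<open>r\<close> on. Below
  \<open>r\<close> the left side is at most \<open>a * r + M\<close>; since \<open>a\<close> is at
  least 1 and the exponent exceeds 1, both terms are absorbed into the power of \<open>a\<close>.
  Keeping \<open>g\<close> a bare number lets it stand for a value of \<open>f\<close> or of its
  dual.\<close>

lemma linear_minus_coercive_le:
  fixes a u g k s r M :: real
  assumes "1 \<le> a" "0 \<le> u" "0 < k" "1 < s" "0 \<le> r" "0 \<le> M"
    and far: "r \<le> u \<Longrightarrow> k * u powr s \<le> g"
    and near: "u < r \<Longrightarrow> - M \<le> g"
  shows "a * u - g \<le> (k powr (- 1 / (s - 1)) + r + M) * a powr (s / (s - 1))"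
proof -
  let ?p = "s / (s - 1)"
  have c: "0 \<le> k powr (- 1 / (s - 1)) * a powr ?p"
    by simp
  have "1 \<le> ?p"
    using assms by (simp add: field_simps)
  then have "a powr 1 \<le> a powr ?p"
    using assms by (intro powr_mono) auto
  then have ap: "a \<le> a powr ?p"
    using assms by simp
  show ?thesis
  proof (cases "r \<le> u")
    case True
    have "a * u - g \<le> k powr (- 1 / (s - 1)) * a powr ?p"
      using linear_minus_powr_le[of a u k s] far[OF True] assms by simp
    also have "\<dots> \<le> (k powr (- 1 / (s - 1)) + r + M) * a powr ?p"
      using assms by (intro mult_right_mono) auto
    finally show ?thesis .
  next
    case False
    have "a * u \<le> a * r"
      using False assms by simp
    also have "\<dots> \<le> r * a powr ?p"
      using mult_left_mono[OF ap, of r] assms by (simp add: mult.commute)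
    finally have "a * u \<le> r * a powr ?p" .
    moreover have "M * 1 \<le> M * a powr ?p"
      using ap assms by (intro mult_left_mono) auto
    ultimately show ?thesis
      using near False c unfolding distrib_right by linarith
  qed
qed

lemma linear_minus_powr_attains:
  fixes a K t r :: real
  assumes "0 < K" "1 < t" "0 < r" and a: "2 * K * r powr (t - 1) \<le> a"
  obtains u where "r \<le> u"
    "a * u - K * u powr t = (2 * K) powr (- 1 / (t - 1)) / 2 * a powr (t / (t - 1))"
proof
  \<comment> \<open>Solves \<open>K * u powr (t - 1) = a / 2\<close>, so that the power term cancels
    exactly half of \<open>a * u\<close>. The lower bound on \<open>a\<close> is what pushes this
    point to \<open>r\<close> or beyond.\<close>
  let ?u = "(a / (2 * K)) powr (1 / (t - 1))"
  have "0 < 2 * K * r powr (t - 1)"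
    using assms by simp
  then have a0: "0 < a"
    using a by linarith
  have "(r powr (t - 1)) powr (1 / (t - 1)) \<le> ?u"
    using assms a0 by (intro powr_mono2) (auto simp: field_simps)
  then show "r \<le> ?u"
    using assms by (simp add: powr_powr)
  have e: "t / (t - 1) = 1 + 1 / (t - 1)"
    using assms by (simp add: field_simps)
  have "?u powr t = (a / (2 * K)) powr (1 + 1 / (t - 1))"
    using assms by (simp add: powr_powr flip: e)
  also have "\<dots> = a / (2 * K) * ?u"
    using a0 assms by (simp add: powr_add)
  finally have "a * ?u - K * ?u powr t = a / 2 * ?u"
    using assms by simp
  also have "\<dots> = (2 * K) powr (- 1 / (t - 1)) / 2 * a powr (t / (t - 1))"
    using a0 assms unfolding e powr_add by (simp add: powr_divide powr_minus_divide)
  finally show "a * ?u - K * ?u powr t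
      = (2 * K) powr (- 1 / (t - 1)) / 2 * a powr (t / (t - 1))" .
qed

lemma obtain_same_direction:
  fixes y :: "'a::real_inner"
  assumes "y \<noteq> 0" "0 \<le> u"
  obtains x where "norm x = u" "y \<bullet> x = norm y * u"
proof
  show "norm ((u / norm y) *\<^sub>R y) = u" "y \<bullet> ((u / norm y) *\<^sub>R y) = norm y * u"
    using assms by (simp_all add: dot_square_norm power2_eq_square)
qed

lemma conjugate_exponent_gt_1: "1 < (s::real) \<Longrightarrow> 1 < s / (s - 1)"
  by (simp add: field_simps)

lemma conjugate_exponent_antimono: "1 < (s::real) \<Longrightarrow> s \<le> t \<Longrightarrow> t / (t - 1) \<le> s / (s - 1)"
  by (simp add: field_simps)

section \<open>Existence of subgradients\<close>

text \<open>A hyperplane through the graph point that supports the epigraph has the subgradient as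
  its slope. It cannot be vertical because \<open>f\<close> is finite on the whole space.\<close>

lemma convex_on_subgradient:
  fixes f :: "'a::euclidean_space \<Rightarrow> real"
  assumes f: "convex_on UNIV f"
  obtains y where "\<And>z. f x + y \<bullet> (z - x) \<le> f z"
proof -
  \<comment> \<open>The strict epigraph, so that the graph point is disjoint from it and separation
    applies.\<close>
  let ?E = "{p. f (fst p) < snd p}"
  have "convex ?E"
  proof (rule convexI)
    fix p q :: "'a \<times> real" and u v :: real
    assume H: "p \<in> ?E" "q \<in> ?E" "0 \<le> u" "0 \<le> v" "u + v = 1"
    have "f (u *\<^sub>R fst p + v *\<^sub>R fst q) \<le> u * f (fst p) + v * f (fst q)"
      using f H by (auto simp: convex_on_def)
    also have "\<dots> < u * snd p + v * snd q"
    \<comment> \<open>Strictness comes from \<open>p\<close> if its weight is positive, and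
      otherwise from \<open>q\<close>, whose weight is then 1.\<close>
    proof (cases "u = 0")
      case False
      have "v * f (fst q) \<le> v * snd q"
        using H by (intro mult_left_mono) auto
      then show ?thesis
        using False H by (intro add_less_le_mono) auto
    qed (use H in auto)
    finally show "u *\<^sub>R p + v *\<^sub>R q \<in> ?E"
      by simp
  qed
  moreover have "(x, f x + 1) \<in> ?E"
    by simp
  then have "?E \<noteq> {}"
    by blast
  moreover have "{(x, f x)} \<inter> ?E = {}"
    by auto
  ultimately obtain a b where a: "a \<noteq> 0" "a \<bullet> (x, f x) \<le> b" "\<forall>p\<in>?E. b \<le> a \<bullet> p"
    using separating_hyperplane_sets[of "{(x, f x)}" ?E] by auto
  obtain w \<alpha> where w: "a = (w, \<alpha>)"
    by (cases a)
  have sep: "w \<bullet> x + \<alpha> * f x \<le> w \<bullet> z + \<alpha> * v" if "f z < v" for z v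
    using a(2) bspec[OF a(3), of "(z, v)"] that by (auto simp: w)
  have "0 \<le> \<alpha>"
    using sep[of x "f x + 1"] by (simp add: algebra_simps)
  \<comment> \<open>A vertical hyperplane would make \<open>w \<bullet> x\<close> a lower bound of
    \<open>w \<bullet> z\<close> over all \<open>z\<close>; moving from \<open>x\<close> by
    \<open>- w\<close> refutes this.\<close>
  moreover have "\<alpha> \<noteq> 0"
  proof
    assume "\<alpha> = 0"
    then have "w \<bullet> x \<le> w \<bullet> (x - w)"
      using sep[of "x - w" "f (x - w) + 1"] by simp
    then have "w \<bullet> w \<le> 0"
      by (simp add: inner_diff_right)
    then have "w = 0"
      by (meson inner_gt_zero_iff not_le)
    then show False
      using a(1) \<open>\<alpha> = 0\<close> by (simp add: w zero_prod_def)
  qed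
  ultimately have \<alpha>: "0 < \<alpha>"
    by simp
  have "f x + (- w /\<^sub>R \<alpha>) \<bullet> (z - x) \<le> f z" for z
  \<comment> \<open>Separation speaks only of heights strictly above the graph, so let
    \<open>v\<close> decrease to \<open>f z\<close>.\<close>
  proof (rule dense_ge)
    fix v assume "f z < v"
    then show "f x + (- w /\<^sub>R \<alpha>) \<bullet> (z - x) \<le> v"
      using sep[of z v] \<alpha> by (simp add: field_simps inner_diff_right)
  qed
  then show ?thesis
    using that by blast
qed

section \<open>Fenchel-Young inequality and its equality case\<close>

lemma fenchel_dual_ge: "ereal (y \<bullet> x - f x) \<le> fenchel_dual f y"
  unfolding fenchel_dual_def by (rule SUP_upper) simp

lemma fenchel_dual_le: "(\<And>x. y \<bullet> x - f x \<le> c) \<Longrightarrow> fenchel_dual f y \<le> ereal c"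
  unfolding fenchel_dual_def by (rule SUP_least) simp

text \<open>Rearranged, the subgradient inequality says that the supremum is attained at
  \<open>x\<close>; in particular the dual is finite at \<open>y\<close>.\<close>

lemma fenchel_dual_subgradient:
  assumes "\<And>z. f x + y \<bullet> (z - x) \<le> f z"
  shows "fenchel_dual f y = ereal (y \<bullet> x - f x)"
proof (rule antisym)
  show "fenchel_dual f y \<le> ereal (y \<bullet> x - f x)"
    using assms by (intro fenchel_dual_le) (simp add: inner_diff_right algebra_simps)
qed (rule fenchel_dual_ge)

section \<open>Transfer of growth bounds between a function and its dual\<close>

theorem lemma6p4:
  fixes f :: "real ^ 'n \<Rightarrow> real"
  assumes "convex_on UNIV f"
  shows "(\<exists>k K s t r :: real. 0 < k \<and> k \<le> K \<and> 1 < s \<and> s \<le> t \<and> 0 < r \<and>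
            (\<forall>x. r \<le> norm x \<longrightarrow> k * norm x powr s \<le> f x \<and> f x \<le> K * norm x powr t))
     \<longleftrightarrow> (\<exists>k' K' s' t' r' :: real. 0 < k' \<and> k' \<le> K' \<and> 1 < s' \<and> s' \<le> t' \<and> 0 < r' \<and>
            (\<forall>y. r' \<le> norm y \<longrightarrow>
               ereal (k' * norm y powr s') \<le> fenchel_dual f y \<and>
               fenchel_dual f y \<le> ereal (K' * norm y powr t')))"
    (is "?a \<longleftrightarrow> ?b")
proof
  assume ?a
  then obtain k K s t r where c: "0 < k" "k \<le> K" "1 < s" "s \<le> t" "0 < r"
    and lo: "\<And>x. r \<le> norm x \<Longrightarrow> k * norm x powr s \<le> f x"
    and up: "\<And>x. r \<le> norm x \<Longrightarrow> f x \<le> K * norm x powr t"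
    by blast
  \<comment> \<open>Inside the ball the growth bounds say nothing; there continuity of
    \<open>f\<close> on a compact set provides the bound \<open>M\<close>.\<close>
  have "continuous_on (cball 0 r) f"
    using convex_on_continuous[OF open_UNIV assms] continuous_on_subset by blast
  then have "bounded (f ` cball 0 r)"
    by (intro compact_imp_bounded compact_continuous_image) auto
  then obtain M where "\<forall>x\<in>cball 0 r. \<bar>f x\<bar> \<le> M"
    by (auto simp: bounded_iff)
  then have M: "\<And>x. norm x \<le> r \<Longrightarrow> \<bar>f x\<bar> \<le> M"
    by simp
  have "0 \<le> M"
    using M[of 0] c by simp
  define C where "C = k powr (- 1 / (s - 1)) + r + M"
  define c' where "c' = (2 * K) powr (- 1 / (t - 1)) / 2"
  \<comment> \<open>The 1 serves the upper bound, where lower-order terms are absorbed; the other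
    entry puts the test point for the lower bound outside radius \<open>r\<close>.\<close>
  define R where "R = max 1 (2 * K * r powr (t - 1))"
  \<comment> \<open>Duality reverses order: the upper exponent \<open>t\<close> yields the lower one
    here, and \<open>s\<close> the upper one. Taking \<open>max c' C\<close> secures the required
    order of the constants.\<close>
  have main: "ereal (c' * norm y powr (t / (t - 1))) \<le> fenchel_dual f y \<and>
      fenchel_dual f y \<le> ereal (max c' C * norm y powr (s / (s - 1)))" if y: "R \<le> norm y" for y
  proof
    obtain u where u: "r \<le> u" "norm y * u - K * u powr t = c' * norm y powr (t / (t - 1))"
      using linear_minus_powr_attains[of K t r "norm y"] c y unfolding c'_def R_def by auto
    obtain x where x: "norm x = u" "y \<bullet> x = norm y * u"
      using obtain_same_direction[of y u] u c y unfolding R_def by force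
    have "ereal (c' * norm y powr (t / (t - 1))) \<le> ereal (y \<bullet> x - f x)"
      using up[of x] u x by simp
    then show "ereal (c' * norm y powr (t / (t - 1))) \<le> fenchel_dual f y"
      using fenchel_dual_ge order_trans by blast
  next
    have "y \<bullet> x - f x \<le> max c' C * norm y powr (s / (s - 1))" for x
    proof -
      have "y \<bullet> x - f x \<le> norm y * norm x - f x"
        by (simp add: norm_cauchy_schwarz)
      also have "\<dots> \<le> C * norm y powr (s / (s - 1))"
        unfolding C_def
      proof (rule linear_minus_coercive_le)
        show "- M \<le> f x" if "norm x < r"
          using M[of x] that by simp
      qed (use c lo \<open>0 \<le> M\<close> y R_def in auto)
      also have "\<dots> \<le> max c' C * norm y powr (s / (s - 1))"
        by (intro mult_right_mono) auto
      finally show ?thesis .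
    qed
    then show "fenchel_dual f y \<le> ereal (max c' C * norm y powr (s / (s - 1)))"
      by (rule fenchel_dual_le)
  qed
  show ?b
    by (rule exI[of _ c'], rule exI[of _ "max c' C"], rule exI[of _ "t / (t - 1)"],
        rule exI[of _ "s / (s - 1)"], rule exI[of _ R])
      (use main c conjugate_exponent_gt_1[of t] conjugate_exponent_antimono[of s t]
        in \<open>auto simp: c'_def R_def\<close>)
next
  assume ?b
  then obtain k K s t r where c: "0 < k" "k \<le> K" "1 < s" "s \<le> t" "0 < r"
    and lo: "\<And>y. r \<le> norm y \<Longrightarrow> ereal (k * norm y powr s) \<le> fenchel_dual f y"
    and up: "\<And>y. r \<le> norm y \<Longrightarrow> fenchel_dual f y \<le> ereal (K * norm y powr t)"
    by blast
  \<comment> \<open>Testing the supremum at 0 bounds the dual below by \<open>- f 0\<close>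
    everywhere, which covers small \<open>y\<close>.\<close>
  define M where "M = \<bar>f 0\<bar>"
  define C where "C = k powr (- 1 / (s - 1)) + r + M"
  define c' where "c' = (2 * K) powr (- 1 / (t - 1)) / 2"
  define R where "R = max 1 (2 * K * r powr (t - 1))"
  have main: "c' * norm x powr (t / (t - 1)) \<le> f x \<and>
      f x \<le> max c' C * norm x powr (s / (s - 1))" if x: "R \<le> norm x" for x
  proof
    obtain u where u: "r \<le> u" "norm x * u - K * u powr t = c' * norm x powr (t / (t - 1))"
      using linear_minus_powr_attains[of K t r "norm x"] c x unfolding c'_def R_def by auto
    obtain y where y: "norm y = u" "x \<bullet> y = norm x * u"
      using obtain_same_direction[of x u] u c x unfolding R_def by force
    have "ereal (y \<bullet> x - f x) \<le> ereal (K * norm y powr t)"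
      using fenchel_dual_ge up[of y] u y order_trans by blast
    then show "c' * norm x powr (t / (t - 1)) \<le> f x"
      using u y by (simp add: inner_commute)
  next
    \<comment> \<open>At a subgradient \<open>f x = y \<bullet> x - g\<close> with \<open>g\<close>
      the real value of the dual. The norm of \<open>y\<close> is not controlled, so both the far
      and the near bound on \<open>g\<close> are supplied.\<close>
    obtain y where sub: "\<And>z. f x + y \<bullet> (z - x) \<le> f z"
      using convex_on_subgradient[OF assms, of x] by blast
    define g where "g = y \<bullet> x - f x"
    have g: "fenchel_dual f y = ereal g"
      unfolding g_def using sub by (rule fenchel_dual_subgradient)
    have "f x \<le> norm x * norm y - g"
      unfolding g_def using norm_cauchy_schwarz[of y x] by (simp add: mult.commute)
    also have "\<dots> \<le> C * norm x powr (s / (s - 1))"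
      unfolding C_def
    proof (rule linear_minus_coercive_le)
      show "k * norm y powr s \<le> g" if "r \<le> norm y"
        using lo[OF that] by (simp add: g)
      show "- M \<le> g"
        using fenchel_dual_ge[of y 0 f] by (simp add: g M_def)
    qed (use c x R_def M_def in auto)
    also have "\<dots> \<le> max c' C * norm x powr (s / (s - 1))"
      by (intro mult_right_mono) auto
    finally show "f x \<le> max c' C * norm x powr (s / (s - 1))" .
  qed
  show ?a
    by (rule exI[of _ c'], rule exI[of _ "max c' C"], rule exI[of _ "t / (t - 1)"],
        rule exI[of _ "s / (s - 1)"], rule exI[of _ R])
      (use main c conjugate_exponent_gt_1[of t] conjugate_exponent_antimono[of s t]
        in \<open>auto simp: c'_def R_def\<close>)
qed

end
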